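(* Let $(\mathfrak g_n,\Lambda)$ be one of the following pairs of an affine type and a level $1$ dominant integral weight: $(A^{(2)}_{2n},\Lambda_0)$; $(A^{(2)}_{2n-1},\Lambda)$ with $\Lambda\in\{\Lambda_0,\Lambda_1\}$; $(B^{(1)}_n,\Lambda)$ with $\Lambda\in\{\Lambda_0,\Lambda_1,\Lambda_n\}$; $(D^{(1)}_n,\Lambda)$ with $\Lambda\in\{\Lambda_0,\Lambda_1,\Lambda_{n-1},\Lambda_n\}$; $(D^{(2)}_{n+1},\Lambda)$ with $\Lambda\in\{\Lambda_0,\Lambda_n\}$. Let $z_3$ and the sets of two-colored partitions $\mathcal{AO}_1,\mathcal{AO}_2$ be the associated ones. Let $X_{z_3}=\{x_1,\dots,x_r\}$ be an arbitrary subset of $\{1,2,\dots,z_3-1\}$ with $1\le x_1<\cdots<x_r<z_3$. For $i=1,2$ let $\mathcal{AO}_i^{X_{z_3}}$ be the subset of $\mathcal{AO}_i$ whose elements contain only parts congruent to $x_j$ modulo $z_3$ for some $1\le j\le r$. Then there is a bijection $$\mathcal{AO}_1^{X_{z_3}}[m]\to\mathcal{AO}_2^{X_{z_3}}[m]\qquad\text{for all } m\in\mathbb Z_{\ge0}.$$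
   Context: **Two-colored partitions.** Let $\mathsf N=\{0\}\sqcup\{1,2,3,\dots\}\sqcup\{\overline1,\overline2,\overline3,\dots\}$ with linear order $\cdots\succ x\succ\overline x\succ x-1\succ\overline{x-1}\succ\cdots\succ1\succ\overline1\succ0$. Both $x$ and $\overline x$ have value $x$; the colour is $c(x)=0$, $c(\overline x)=1$. Sums and differences in $\mathsf N$ (differences $a-b$ for $a\succeq b$) are formed by adding, respectively subtracting, values and colours (colours mod $2$), with $a-b=0$ if the values agree. For an integer $k\ge1$ and $x\in\mathsf N$, $k\cdot x$ has value $k$ times the value of $x$ and the same colour as $x$ (and $0\cdot x=0$). "A multiple of $u$" means $k\cdot u$ in this sense, so it is non-overlined. Congruences of elements of $\mathsf N$ refer to values. A two-colored partition is a sequence $\lambda=(\lambda_1,\lambda_2,\dots)$ in $\mathsf N$ with $\lambda_i\succeq\lambda_{i+1}$ and finitely many nonzero terms; its parts are its nonzero terms. It is a two-colored partition of $m$ if the values of its parts sum to $m$; for a set $\mathcal A$ of two-colored partitions, $\mathcal A[m]$ is the set of its members that are two-colored partitions of $m$. **Constants $(z_1,z_2,z_3)$, $u$, $v$.** - $A^{(2)}_{2n}$: $(0,0,2n+1)$, $u=v=2n+1$. - $A^{(2)}_{2n-1}$: $(2n-1,0,2n-1)$, $u=v=2n-1$. - $B^{(1)}_n$, $\Lambda\in\{\Lambda_0,\Lambda_1\}$: $(2n,0,n)$, $u=v=2n$. - $B^{(1)}_n$, $\Lambda=\Lambda_n$: $(n,2n,n)$, $u=v=2n$. - $D^{(1)}_n$: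 $(n-1,0,n-1)$, $u=2n-2$, $v=n-1$. - $D^{(2)}_{n+1}$: $(0,0,n+1)$, $u=2n+2$, $v=n+1$. **The set $\mathcal Z(\Lambda)$** consists of the two-colored partitions $\lambda$ such that: (i) for no $x\ge1$ are both $x$ and $\overline x$ parts of $\lambda$; (ii) every $\lambda_i$ is a non-negative (non-overlined) integer, or $\overline{z_1}$, or of the form $\overline{z_1k+z_2}$ with $k\ge1$; in the case $(z_1,z_2)=(0,0)$ this means that no overlined parts are allowed. (So the allowed overlined parts $\overline x$ are: $x$ a multiple of $2n-1$ for $A^{(2)}_{2n-1}$; $x$ a multiple of $2n$ for $B^{(1)}_n$, $\Lambda\in\{\Lambda_0,\Lambda_1\}$; $x=n$ or $x=kn+2n$ with $k\ge1$ for $B^{(1)}_n$, $\Lambda=\Lambda_n$; $x$ a multiple of $n-1$ for $D^{(1)}_n$; none for $A^{(2)}_{2n}$, $D^{(2)}_{n+1}$.) (iii) $\lambda_i=\lambda_{i+1}\succ0$ is allowed only if $\lambda_i$ is one of $k\cdot z_1+z_2$, $k\cdot\overline{z_1}+z_2$, $z_1$, $\overline{z_1}$, $k\cdot z_3$ for some $k\in\mathbb Z_{\ge0}$. **The set $\mathcal{AO}_1=\mathcal{AO}_1(\Lambda)$** consists of the $\lambda\in\mathcal Z(\Lambda)$ such that the difference between successive parts is at most $u$, the smallest part is strictly less than $u$, and the difference between successive parts is strictly less than $u$ if either part is congruent to $z_3$, $\overline{z_3}$ or $0$ modulo $v$ (all comparisons with respect to $\succ$). **The set $\mathcal{AO}_2=\mathcal{AO}_2(\Lambda)$**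 consists of the $\lambda\in\mathcal Z(\Lambda)$ such that: - $A^{(2)}_{2n-1}$: no part is a multiple of $u$ and no part is repeated; - $A^{(2)}_{2n}$; $B^{(1)}_n$ with $\Lambda=\Lambda_n$; $D^{(1)}_n$: no part is a multiple of $u$; - $B^{(1)}_n$ with $\Lambda\ne\Lambda_n$: no part is a multiple of $u$, and only the parts congruent to $z_1$ modulo $u$ can be repeated; - $D^{(2)}_{n+1}$: no part is repeated.
   Formalization: The claim is false as worded (A_2^(2), X={1}, m=4: the partition (4) has no counterpart); in the formal statement the elements of AO_1^X may also contain parts that are multiples of u, while AO_2^X is as stated. *)

theory Defs
  imports "HOL-Library.Z2" "HOL-Number_Theory.Cong"
begin

subsection \<open>Two-colored numbers\<close>

text \<open>A pair (value, colour), colour 1 meaning overlined; 0 exists only in colour 0.\<close>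

typedef cnum = "{p :: nat \<times> bit. fst p = 0 \<longrightarrow> snd p = 0}"
  morphisms rep_cnum abs_cnum
  by (rule exI[of _ "(0, 0)"]) simp

setup_lifting type_definition_cnum

lift_definition val :: "cnum \<Rightarrow> nat" is fst .

lift_definition col :: "cnum \<Rightarrow> bit" is snd .

lift_definition plain :: "nat \<Rightarrow> cnum" is "\<lambda>x. (x, 0)" by simp

text \<open>The number \<open>x\<close> overlined for \<open>x \<ge> 1\<close>; by convention \<open>over 0 = 0\<close>.\<close>

lift_definition over :: "nat \<Rightarrow> cnum" is "\<lambda>x. (x, if x = 0 then 0 else 1)" by simp

lift_definition scale :: "nat \<Rightarrow> cnum \<Rightarrow> cnum"
  is "\<lambda>k p. if k = 0 then (0, 0) else (k * fst p, snd p)" by auto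

lemma cnum_eq_iff: "a = b \<longleftrightarrow> val a = val b \<and> col a = col b"
  by transfer (auto simp: prod_eq_iff)

instantiation cnum :: "{zero, plus, minus, linorder}"
begin

lift_definition zero_cnum :: cnum is "(0, 0)" by simp

lift_definition plus_cnum :: "cnum \<Rightarrow> cnum \<Rightarrow> cnum"
  is "\<lambda>p q. (fst p + fst q, snd p + snd q)" by simp

text \<open>Only used for \<open>a \<ge> b\<close>. Equal values give 0, whatever the colours.\<close>

lift_definition minus_cnum :: "cnum \<Rightarrow> cnum \<Rightarrow> cnum"
  is "\<lambda>p q. if fst p \<le> fst q then (0, 0) else (fst p - fst q, snd p - snd q)" by auto

text \<open>For equal values the overlined number is the smaller one.\<close>

definition less_eq_cnum :: "cnum \<Rightarrow> cnum \<Rightarrow> bool" where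
  "a \<le> b \<longleftrightarrow> val a < val b \<or> val a = val b \<and> (col b = 1 \<longrightarrow> col a = 1)"

definition less_cnum :: "cnum \<Rightarrow> cnum \<Rightarrow> bool" where
  "a < b \<longleftrightarrow> a \<le> b \<and> \<not> b \<le> (a :: cnum)"

instance
proof
  fix a b c :: cnum
  show "a \<le> b \<Longrightarrow> b \<le> a \<Longrightarrow> a = b"
    by (cases "col a"; cases "col b") (auto simp: less_eq_cnum_def cnum_eq_iff)
qed (auto simp: less_eq_cnum_def less_cnum_def)

end

subsection \<open>Two-colored partitions\<close>

text \<open>The term \<open>\<mu> i\<close> of the sequence is the \<open>(i + 1)\<close>-st entry of the partition.\<close>

definition two_colored_partition :: "(nat \<Rightarrow> cnum) \<Rightarrow> bool" where
  "two_colored_partition \<mu> \<longleftrightarrow> (\<forall>i. \<mu> (Suc i) \<le> \<mu> i) \<and> finite {i. \<mu> i \<noteq> 0}"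

definition parts :: "(nat \<Rightarrow> cnum) \<Rightarrow> cnum set" where
  "parts \<mu> = range \<mu> - {0}"

definition repeated_parts :: "(nat \<Rightarrow> cnum) \<Rightarrow> cnum set" where
  "repeated_parts \<mu> = {p \<in> parts \<mu>. \<exists>i. \<mu> i = p \<and> \<mu> (Suc i) = p}"

definition of_size :: "(nat \<Rightarrow> cnum) set \<Rightarrow> nat \<Rightarrow> (nat \<Rightarrow> cnum) set" where
  "of_size \<A> m = {\<mu> \<in> \<A>. (\<Sum>i | \<mu> i \<noteq> 0. val (\<mu> i)) = m}"

definition multiple_of :: "nat \<Rightarrow> cnum \<Rightarrow> bool" where
  "multiple_of u p \<longleftrightarrow> (\<exists>k. p = scale k (plain u))"

subsection \<open>Affine types and constants\<close>

text \<open>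
  With the parameter \<open>n\<close>, the constructors stand for
  \<open>A\<^bsub>2n\<^esub>\<^bsup>(2)\<^esup>\<close>, \<open>A\<^bsub>2n-1\<^esub>\<^bsup>(2)\<^esup>\<close>, \<open>B\<^bsub>n\<^esub>\<^bsup>(1)\<^esup>\<close>, \<open>D\<^bsub>n\<^esub>\<^bsup>(1)\<^esup>\<close>, \<open>D\<^bsub>n+1\<^esub>\<^bsup>(2)\<^esup>\<close>.
  The weight \<open>\<Lambda>\<^sub>i\<close> is represented by its index \<open>i\<close>.
\<close>

datatype affine_type = A2_even nat | A2_odd nat | B1 nat | D1 nat | D2 nat

text \<open>The lower bounds on \<open>n\<close> are the usual ones in the classification of affine types.\<close>

fun level1_pair :: "affine_type \<Rightarrow> nat \<Rightarrow> bool" where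
  "level1_pair (A2_even n) i \<longleftrightarrow> n \<ge> 1 \<and> i = 0"
| "level1_pair (A2_odd n) i \<longleftrightarrow> n \<ge> 3 \<and> i \<in> {0, 1}"
| "level1_pair (B1 n) i \<longleftrightarrow> n \<ge> 3 \<and> i \<in> {0, 1, n}"
| "level1_pair (D1 n) i \<longleftrightarrow> n \<ge> 4 \<and> i \<in> {0, 1, n - 1, n}"
| "level1_pair (D2 n) i \<longleftrightarrow> n \<ge> 2 \<and> i \<in> {0, n}"

fun z1_of :: "affine_type \<Rightarrow> nat \<Rightarrow> nat" where
  "z1_of (A2_even n) i = 0"
| "z1_of (A2_odd n) i = 2 * n - 1"
| "z1_of (B1 n) i = (if i = n then n else 2 * n)"
| "z1_of (D1 n) i = n - 1"
| "z1_of (D2 n) i = 0"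

fun z2_of :: "affine_type \<Rightarrow> nat \<Rightarrow> nat" where
  "z2_of (B1 n) i = (if i = n then 2 * n else 0)"
| "z2_of _ i = 0"

fun z3_of :: "affine_type \<Rightarrow> nat \<Rightarrow> nat" where
  "z3_of (A2_even n) i = 2 * n + 1"
| "z3_of (A2_odd n) i = 2 * n - 1"
| "z3_of (B1 n) i = n"
| "z3_of (D1 n) i = n - 1"
| "z3_of (D2 n) i = n + 1"

fun u_of :: "affine_type \<Rightarrow> nat \<Rightarrow> nat" where
  "u_of (A2_even n) i = 2 * n + 1"
| "u_of (A2_odd n) i = 2 * n - 1"
| "u_of (B1 n) i = 2 * n"
| "u_of (D1 n) i = 2 * n - 2"
| "u_of (D2 n) i = 2 * n + 2"

fun v_of :: "affine_type \<Rightarrow> nat \<Rightarrow> nat" where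
  "v_of (A2_even n) i = 2 * n + 1"
| "v_of (A2_odd n) i = 2 * n - 1"
| "v_of (B1 n) i = 2 * n"
| "v_of (D1 n) i = n - 1"
| "v_of (D2 n) i = n + 1"

subsection \<open>The sets of partitions\<close>

text \<open>If \<open>z1 = z2 = 0\<close>, then all \<open>over\<close> terms in \<open>\<Z>_allowed\<close> are 0, so no overlined part is allowed.\<close>

definition Z_allowed :: "affine_type \<Rightarrow> nat \<Rightarrow> cnum set" where
  "Z_allowed t i = (let z1 = z1_of t i; z2 = z2_of t i in
     range plain \<union> {over z1} \<union> {over (z1 * k + z2) | k. k \<ge> 1})"

definition Z_repeatable :: "affine_type \<Rightarrow> nat \<Rightarrow> cnum set" where
  "Z_repeatable t i = (let z1 = z1_of t i; z2 = z2_of t i; z3 = z3_of t i in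
     (\<Union>k. {scale k (plain z1) + plain z2, scale k (over z1) + plain z2,
           plain z1, over z1, scale k (plain z3)}))"

definition Z_set :: "affine_type \<Rightarrow> nat \<Rightarrow> (nat \<Rightarrow> cnum) set" where
  "Z_set t i = {\<mu>. two_colored_partition \<mu> \<and>
     (\<nexists>x. x \<ge> 1 \<and> plain x \<in> parts \<mu> \<and> over x \<in> parts \<mu>) \<and>
     range \<mu> \<subseteq> Z_allowed t i \<and>
     repeated_parts \<mu> \<subseteq> Z_repeatable t i}"

definition cong_special :: "affine_type \<Rightarrow> nat \<Rightarrow> cnum \<Rightarrow> bool" where
  "cong_special t i p \<longleftrightarrow>
     (\<exists>q \<in> {plain (z3_of t i), over (z3_of t i), 0}. [val p = val q] (mod v_of t i))"

definition AO1 :: "affine_type \<Rightarrow> nat \<Rightarrow> (nat \<Rightarrow> cnum) set" where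
  "AO1 t i = {\<mu> \<in> Z_set t i. let u = plain (u_of t i) in
     (\<forall>j. \<mu> (Suc j) \<noteq> 0 \<longrightarrow>
        \<mu> j - \<mu> (Suc j) \<le> u \<and>
        (cong_special t i (\<mu> j) \<or> cong_special t i (\<mu> (Suc j)) \<longrightarrow> \<mu> j - \<mu> (Suc j) < u)) \<and>
     (parts \<mu> \<noteq> {} \<longrightarrow> Min (parts \<mu>) < u)}"

fun AO2_condition :: "affine_type \<Rightarrow> nat \<Rightarrow> (nat \<Rightarrow> cnum) \<Rightarrow> bool" where
  "AO2_condition (A2_odd n) i \<mu> \<longleftrightarrow>
     (\<forall>p \<in> parts \<mu>. \<not> multiple_of (u_of (A2_odd n) i) p) \<and> repeated_parts \<mu> = {}"
| "AO2_condition (B1 n) i \<mu> \<longleftrightarrow>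
     (\<forall>p \<in> parts \<mu>. \<not> multiple_of (u_of (B1 n) i) p) \<and>
     (i \<noteq> n \<longrightarrow> (\<forall>p \<in> repeated_parts \<mu>. [val p = z1_of (B1 n) i] (mod u_of (B1 n) i)))"
| "AO2_condition (D2 n) i \<mu> \<longleftrightarrow> repeated_parts \<mu> = {}"
| "AO2_condition (A2_even n) i \<mu> \<longleftrightarrow> (\<forall>p \<in> parts \<mu>. \<not> multiple_of (u_of (A2_even n) i) p)"
| "AO2_condition (D1 n) i \<mu> \<longleftrightarrow> (\<forall>p \<in> parts \<mu>. \<not> multiple_of (u_of (D1 n) i) p)"

definition AO2 :: "affine_type \<Rightarrow> nat \<Rightarrow> (nat \<Rightarrow> cnum) set" where
  "AO2 t i = {\<mu> \<in> Z_set t i. AO2_condition t i \<mu>}"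

definition cong_to_some :: "affine_type \<Rightarrow> nat \<Rightarrow> nat set \<Rightarrow> cnum \<Rightarrow> bool" where
  "cong_to_some t i X p \<longleftrightarrow> (\<exists>x \<in> X. [val p = x] (mod z3_of t i))"

text \<open>
  As in the Andrews-Olsson identity, the residue condition exempts the multiples of \<open>u\<close> in the
  first family, but binds every part in the second. If it bound every part of the first family
  too, the two families would not be equinumerous: take \<open>X = {1}\<close> and size \<open>u + 1\<close>. The one-part
  partition \<open>(u + 1)\<close> lies in the second family. It is not in the first, whose only member of
  that size is \<open>(u, 1)\<close>, and this one would be lost.
\<close>

definition AO1_res :: "affine_type \<Rightarrow> nat \<Rightarrow> nat set \<Rightarrow> (nat \<Rightarrow> cnum) set" where
  "AO1_res t i X =
     {\<mu> \<in> AO1 t i. \<forall>p \<in> parts \<mu>. multiple_of (u_of t i) p \<or> cong_to_some t i X p}"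

definition AO2_res :: "affine_type \<Rightarrow> nat \<Rightarrow> nat set \<Rightarrow> (nat \<Rightarrow> cnum) set" where
  "AO2_res t i X = {\<mu> \<in> AO2 t i. \<forall>p \<in> parts \<mu>. cong_to_some t i X p}"

end

theory Submission
  imports Defs
begin

text \<open>
  Put \<open>N = u\<close>. Elements of \<open>X\<close> are nonzero residues modulo \<open>z3\<close>, whereas every overlined
  and every repeatable number admitted by \<open>\<Z>\<close> has a value divisible by \<open>z3\<close>. Hence all parts in question are
  plain, a part that is not a multiple of \<open>N\<close> occurs only once, and the list of types collapses to a
  single statement, the Andrews-Olsson identity: partitions into distinct parts with prescribed
  nonzero residues modulo \<open>N\<close> are equinumerous with the partitions that may in addition contain
  repeated multiples of \<open>N\<close>, but have smallest part below \<open>N\<close> and differences of successive parts at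
  most \<open>N\<close>, and less than \<open>N\<close> next to a multiple of \<open>N\<close>. Partitions are treated as weakly
  increasing lists of numbers.

  A finer statement is proved: there is a bijection that preserves the sum and also the sequence
  \<open>r\<^sub>1, \<dots>, r\<^sub>k\<close> of the residues modulo \<open>N\<close> of the non-multiples of \<open>N\<close>, read from the smallest part
  upwards (\<open>bij_betw_gap_distinct_lists\<close>). Fix this sequence.

  On the distinct side, a list is determined by the quotients of its parts by \<open>N\<close>, and these are
  constrained only by weak monotonicity, with strict growth from part \<open>i\<close> to part \<open>i + 1\<close> wherever
  \<open>r\<^bsub>i+1\<^esub> \<le> r\<^sub>i\<close>. Subtracting the least possible quotients leaves an arbitrary partition with at most
  \<open>k\<close> parts. Let \<open>c\<^sub>j\<close> be the number of columns of height \<open>j\<close> in its diagram; then the sum of the list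
  is a constant plus \<open>N * (\<Sum>j. j * c\<^sub>j)\<close>.

  On the other side, between two successive non-multiples, and also above the largest one, there
  is room for copies of a single multiple of \<open>N\<close>, whose value is forced by the non-multiple below.
  The multiplicities \<open>m\<^sub>1, \<dots>, m\<^sub>k\<close> of these copies are arbitrary and determine the list, but the sum
  is not linear in them: if \<open>r\<^sub>i < r\<^bsub>i+1\<^esub>\<close>, then the quotient increases from part \<open>i\<close> to part \<open>i + 1\<close>
  exactly when \<open>m\<^sub>i\<close> is positive. The recoding \<open>record_gaps\<close> of \<open>m\<close> as \<open>c\<close> compensates for this. At
  such a gap, above a part with quotient \<open>q\<close> and with \<open>l\<close> non-multiples still to come, it realises
  \[ \prod_{j=1}^{l+1} \frac{1}{1-x^{q+j}}
     = \prod_{j=1}^{l} \frac{1}{1-x^{q+j}} + x^{q+l+1} \prod_{j=1}^{l+1} \frac{1}{1-x^{q+j}}. \]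
  The first summand belongs to \<open>m\<^sub>i = 0\<close>. In the second, one copy of \<open>(q + 1) N\<close> together with the
  raising of the \<open>l\<close> later parts by \<open>N\<close> costs \<open>(q + l + 1) N\<close>, which is one more column of the
  greatest height.
\<close>

section \<open>Bijections that preserve a weight\<close>

lemma bij_betw_Collect:
  assumes "bij_betw f A B" "\<And>a. a \<in> A \<Longrightarrow> Q (f a) \<longleftrightarrow> P a"
  shows "bij_betw f {a \<in> A. P a} {b \<in> B. Q b}"
proof (rule bij_betw_subset[OF assms(1)])
  have "B = f ` A" using bij_betw_imp_surj_on[OF assms(1)] by simp
  then show "f ` {a \<in> A. P a} = {b \<in> B. Q b}" using assms(2) by blast
qed blast

lemma bij_betw_match:
  assumes "bij_betw g C A" "bij_betw h C B" "\<And>c. c \<in> C \<Longrightarrow> w' (h c) = w (g c)"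
  shows "\<exists>f. bij_betw f A B \<and> (\<forall>a\<in>A. w' (f a) = w a)"
proof (intro exI conjI ballI)
  show "bij_betw (h \<circ> inv_into C g) A B"
    using bij_betw_inv_into[OF assms(1)] assms(2) by (rule bij_betw_trans)
  fix a assume "a \<in> A"
  then have "inv_into C g a \<in> C" "g (inv_into C g a) = a"
    using assms(1) by (auto simp: bij_betw_def inv_into_into f_inv_into_f)
  then show "w' ((h \<circ> inv_into C g) a) = w a" using assms(3) by force
qed

section \<open>Two families of lists\<close>

definition residues :: "nat \<Rightarrow> nat list \<Rightarrow> nat list" where
  "residues N l = map (\<lambda>x. x mod N) (filter (\<lambda>x. \<not> N dvd x) l)"

text \<open>
  The condition on a part \<open>a\<close> and the next larger part \<open>b\<close> in a partition of the first family: the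
  bounds on the difference, and no repetition except for multiples of \<open>N\<close>.
\<close>

definition gap_step :: "nat \<Rightarrow> nat \<Rightarrow> nat \<Rightarrow> bool" where
  "gap_step N a b \<longleftrightarrow> a \<le> b \<and> b \<le> a + N \<and> (a = b \<longrightarrow> N dvd a) \<and> (N dvd a \<or> N dvd b \<longrightarrow> b < a + N)"

definition gap_lists :: "nat \<Rightarrow> nat list set" where
  "gap_lists N = {l. successively (gap_step N) l \<and> (l \<noteq> [] \<longrightarrow> 0 < hd l \<and> hd l < N)}"

definition distinct_lists :: "nat \<Rightarrow> nat list set" where
  "distinct_lists N = {l. successively (<) l \<and> (\<forall>x\<in>set l. \<not> N dvd x)}"

text \<open>
  The sum of the smallest increasing list with residues \<open>rs\<close> that can be put above the number
  \<open>q * N + s\<close>. The quotient must grow exactly when the residue does not.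
\<close>

primrec least_sum :: "nat \<Rightarrow> nat \<Rightarrow> nat \<Rightarrow> nat list \<Rightarrow> nat" where
  "least_sum N q s [] = 0"
| "least_sum N q s (r # rs) =
     (let q' = (if r \<le> s then Suc q else q) in q' * N + r + least_sum N q' r rs)"

text \<open>
  The \<open>j\<close>-th entry (from 0) counts columns of height \<open>q + 1 + j\<close>.
\<close>

primrec column_weight :: "nat \<Rightarrow> nat list \<Rightarrow> nat" where
  "column_weight q [] = 0"
| "column_weight q (c # cs) = Suc q * c + column_weight (Suc q) cs"

text \<open>
  The quotients of the smallest list above \<open>q * N + s\<close> differ from \<open>q\<close> by numbers that depend only
  on the residues.
\<close>

lemma least_sum_shift: "least_sum N (q + c) s rs = least_sum N q s rs + N * c * length rs"
proof (induction rs arbitrary: q s)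
  case (Cons r rs)
  show ?case using Cons.IH[of "Suc q" r] Cons.IH[of q r] by (simp add: Let_def algebra_simps)
qed simp

lemma least_sum_Suc: "least_sum N (Suc q) s rs = least_sum N q s rs + N * length rs"
  using least_sum_shift[of N q 1] by simp

lemma column_weight_snoc:
  "column_weight q (cs @ [c]) = column_weight q cs + (Suc q + length cs) * c"
  by (induction cs arbitrary: q) (auto simp: algebra_simps)

section \<open>Lists of distinct non-multiples and their columns\<close>

text \<open>
  The list above \<open>q * N + s\<close> with residues \<open>rs\<close> in which \<open>cs\<close> counts the columns added to the
  smallest such list. A column of full height \<open>length rs\<close> raises every element, so the number of
  these, the last entry of \<open>cs\<close>, is the excess of the first quotient over its least value; the
  shorter columns concern the remaining elements only.
\<close>

primrec distinct_list :: "nat \<Rightarrow> nat \<Rightarrow> nat \<Rightarrow> nat list \<Rightarrow> nat list \<Rightarrow> nat list" where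
  "distinct_list N q s [] cs = []"
| "distinct_list N q s (r # rs) cs =
     (let q' = (if r \<le> s then Suc q else q) + last cs
      in (q' * N + r) # distinct_list N q' r rs (butlast cs))"

lemma sum_distinct_list:
  "length cs = length rs \<Longrightarrow>
     sum_list (distinct_list N q s rs cs) = least_sum N q s rs + N * column_weight 0 cs"
proof (induction rs arbitrary: q s cs)
  case (Cons r rs)
  then obtain cs' c where cs: "cs = cs' @ [c]" "length cs' = length rs"
    by (metis append_butlast_last_id length_butlast diff_Suc_1 length_Cons length_0_conv list.distinct(1))
  then show ?case
    using least_sum_shift[of N "Suc q" c r rs] least_sum_shift[of N q c r rs]
    by (simp add: Cons.IH Let_def column_weight_snoc algebra_simps)
qed simp

text \<open>
  This is why the residues alone decide where the quotients must grow strictly.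
\<close>

lemma quotient_remainder_less_iff:
  fixes N q s d r :: nat
  assumes "s < N" "r < N"
  shows "q * N + s < d * N + r \<longleftrightarrow> (if r \<le> s then Suc q else q) \<le> d"
proof -
  consider "Suc d \<le> q" | "d = q" | "Suc q \<le> d" by linarith
  then show ?thesis
  proof cases
    case 1
    then have "Suc d * N \<le> q * N" by (rule mult_le_mono1)
    then show ?thesis using assms 1 by simp
  next
    case 3
    then have "Suc q * N \<le> d * N" by (rule mult_le_mono1)
    then show ?thesis using assms 3 by simp
  qed auto
qed

lemma distinct_list_chain:
  assumes "length cs = length rs" "set rs \<subseteq> {0<..<N}" "s < N"
  shows "successively (<) ((q * N + s) # distinct_list N q s rs cs)"
    and "residues N (distinct_list N q s rs cs) = rs"
    and "\<forall>x\<in>set (distinct_list N q s rs cs). \<not> N dvd x"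
  using assms
proof (induction rs arbitrary: q s cs)
  case (Cons r rs)
  {
    case 1
    then show ?case
      using Cons.IH(1)[of "butlast cs" r] 
      by (auto simp: Let_def quotient_remainder_less_iff)
  next
    case 2
    then show ?case
      using Cons.IH(2)[of "butlast cs" r] 
      by (auto simp: Let_def residues_def dvd_eq_mod_eq_0)
  next
    case 3
    then show ?case
      using Cons.IH(3)[of "butlast cs" r] 
      by (auto simp: Let_def dvd_eq_mod_eq_0)
  }
qed (auto simp: residues_def)

text \<open>
  The column counts are recovered from the bottom up: the excess of the first quotient is the last
  entry of \<open>cs\<close>.
\<close>

lemma distinct_list_surj:
  assumes "successively (<) ((q * N + s) # l)" "\<forall>x\<in>set l. \<not> N dvd x" "s < N"
  shows "\<exists>cs. length cs = length (residues N l) \<and> distinct_list N q s (residues N l) cs = l"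
  using assms
proof (induction l arbitrary: q s)
  case (Cons x l)
  define r where "r = x mod N"
  define q' where "q' = (if r \<le> s then Suc q else q)"
  have "q * N + s < x" using Cons.prems by simp
  then have le: "q' \<le> x div N"
    using quotient_remainder_less_iff[of s N r q "x div N"] Cons.prems(3) by (simp add: r_def q'_def)
  have "successively (<) ((x div N * N + r) # l)" using Cons.prems by (simp add: r_def)
  then obtain cs where cs: "length cs = length (residues N l)"
      "distinct_list N (x div N) r (residues N l) cs = l"
    using Cons.IH[of "x div N" r] Cons.prems by (auto simp: r_def)
  have res: "residues N (x # l) = r # residues N l"
    using Cons.prems(2) by (simp add: residues_def r_def)
  show ?case
  proof (intro exI conjI)
    show "length (cs @ [x div N - q']) = length (residues N (x # l))" using cs res by simp
    show "distinct_list N q s (residues N (x # l)) (cs @ [x div N - q']) = x # l"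
      unfolding res using cs(2) le by (simp add: Let_def flip: q'_def) (simp add: r_def)
  qed
qed (simp add: residues_def)

lemma distinct_list_inj:
  assumes "length cs = length rs" "length cs' = length rs" "0 < N"
    "distinct_list N q s rs cs = distinct_list N q s rs cs'"
  shows "cs = cs'"
  using assms
proof (induction rs arbitrary: q s cs cs')
  case (Cons r rs)
  define q' where "q' = (if r \<le> s then Suc q else q)"
  have ne: "cs \<noteq> []" "cs' \<noteq> []" using Cons.prems by auto
  have last: "last cs = last cs'" using Cons.prems(3,4) by (simp add: Let_def)
  have "distinct_list N (q' + last cs) r rs (butlast cs) =
      distinct_list N (q' + last cs) r rs (butlast cs')"
    using Cons.prems(4) unfolding q'_def last distinct_list.simps Let_def list.inject by (rule conjunct2)
  then have "butlast cs = butlast cs'" using Cons.prems(1-3) Cons.IH[of "butlast cs" "butlast cs'"] by simp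
  then show ?case using ne last by (metis append_butlast_last_id)
qed simp

lemma bij_betw_distinct_list:
  assumes "set rs \<subseteq> {0<..<N}" "0 < N"
  shows "bij_betw (distinct_list N 0 0 rs) {cs. length cs = length rs}
           {l \<in> distinct_lists N. residues N l = rs}"
proof (rule bij_betw_imageI)
  show "inj_on (distinct_list N 0 0 rs) {cs. length cs = length rs}"
    by (intro inj_onI) (use distinct_list_inj[OF _ _ assms(2)] in blast)
  have "\<exists>cs. length cs = length rs \<and> l = distinct_list N 0 0 rs cs"
    if "l \<in> distinct_lists N" "residues N l = rs" for l
  proof -
    have "successively (<) ((0 * N + 0) # l)"
    proof (cases l)
      case (Cons a l')
      then have "\<not> N dvd a" using that by (simp add: distinct_lists_def)
      then have "a \<noteq> 0" by (metis dvd_0_right)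
      then show ?thesis using that Cons by (simp add: distinct_lists_def)
    qed simp
    then show ?thesis
      using distinct_list_surj[of 0 N 0 l] that assms(2) by (simp add: distinct_lists_def) metis
  qed
  moreover have "distinct_list N 0 0 rs cs \<in> distinct_lists N \<and> residues N (distinct_list N 0 0 rs cs) = rs"
    if "length cs = length rs" for cs
    using distinct_list_chain[OF that assms, of 0]
    by (cases "distinct_list N 0 0 rs cs") (simp_all add: distinct_lists_def)
  ultimately show "distinct_list N 0 0 rs ` {cs. length cs = length rs}
      = {l \<in> distinct_lists N. residues N l = rs}"
    by blast
qed

section \<open>Lists with bounded gaps and their multiplicities\<close>

text \<open>
  The list above \<open>q * N + s\<close> with residues \<open>rs\<close> in which \<open>ms\<close> gives the multiplicities of the
  multiples of \<open>N\<close>: first those directly above \<open>q * N + s\<close>, last those above all non-multiples. Among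
  these only \<open>(q + 1) * N\<close> is close enough to \<open>q * N + s\<close>, and the next non-multiple lies above it as soon as one
  copy is present; without a copy it is the first number above \<open>q * N + s\<close> with its residue.
\<close>

primrec gap_list :: "nat \<Rightarrow> nat \<Rightarrow> nat \<Rightarrow> nat list \<Rightarrow> nat list \<Rightarrow> nat list" where
  "gap_list N q s [] ms = replicate (hd ms) (Suc q * N)"
| "gap_list N q s (r # rs) ms =
     (let q' = (if r \<le> s \<or> 0 < hd ms then Suc q else q)
      in replicate (hd ms) (Suc q * N) @ (q' * N + r) # gap_list N q' r rs (tl ms))"

lemma gap_step_from_multiple:
  assumes "0 < N"
  shows "gap_step N (j * N) x \<longleftrightarrow> (\<exists>r<N. x = j * N + r)"
proof
  assume "gap_step N (j * N) x"
  then have "x - j * N < N" "x = j * N + (x - j * N)" by (auto simp: gap_step_def)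
  then show "\<exists>r<N. x = j * N + r" by blast
qed (auto simp: gap_step_def)

text \<open>
  Above a non-multiple a step is at most \<open>N\<close>, so each residue class is reached in one way only, and
  the class of 0 is reached in the next multiple of \<open>N\<close>.
\<close>

lemma gap_step_from_nonmultiple:
  assumes "0 < s" "s < N"
  shows "gap_step N (q * N + s) x \<longleftrightarrow>
    x = Suc q * N \<or> (\<exists>r. 0 < r \<and> r < N \<and> x = (if r \<le> s then Suc q else q) * N + r)"
    (is "_ \<longleftrightarrow> _ \<or> ?R")
proof
  assume st: "gap_step N (q * N + s) x"
  have nd: "\<not> N dvd q * N + s" using assms by (auto simp: dvd_eq_mod_eq_0)
  have "q * N + s \<le> x" "q * N + s \<noteq> x" using st nd by (auto simp: gap_step_def)
  then have lt: "q * N + s < x" by linarith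
  have le: "x \<le> Suc q * N + s" using st by (auto simp: gap_step_def)
  show "x = Suc q * N \<or> ?R"
  proof (cases "x < Suc q * N")
    case True
    then have "s < x - q * N" "x - q * N < N" "x = q * N + (x - q * N)" using lt by auto
    then show ?thesis by (intro disjI2 exI[of _ "x - q * N"]) auto
  next
    case False
    then have "x - Suc q * N \<le> s" "x = Suc q * N + (x - Suc q * N)" using le by auto
    then show ?thesis using assms
      by (cases "x = Suc q * N") (auto intro!: exI[of _ "x - Suc q * N"])
  qed
next
  have 1: "\<not> N dvd q * N + s" using assms by (auto simp: dvd_eq_mod_eq_0)
  have 2: "\<not> N dvd q * N + r" if "0 < r" "r < N" for q r
    using that by (simp add: dvd_eq_mod_eq_0)
  assume "x = Suc q * N \<or> ?R"
  then show "gap_step N (q * N + s) x"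
    using assms 1 2[of _ q] 2[of _ "Suc q"] by (auto simp: gap_step_def split: if_splits)
qed

lemma successively_replicate_multiple:
  assumes "0 < N"
  shows "successively (gap_step N) (j * N # replicate m (j * N) @ l) \<longleftrightarrow>
         successively (gap_step N) (j * N # l)"
  using assms by (induction m) (auto simp: gap_step_from_multiple)

lemma successively_multiple_split:
  assumes "0 < N" "successively (gap_step N) (j * N # l)"
  shows "\<exists>m l'. l = replicate m (j * N) @ l' \<and>
    (l' = [] \<or> (\<exists>r l''. 0 < r \<and> r < N \<and> l' = (j * N + r) # l'' \<and> successively (gap_step N) l'))"
  using assms(2)
proof (induction l)
  case (Cons x l)
  then obtain r where r: "r < N" "x = j * N + r"
    using assms(1) by (auto simp: gap_step_from_multiple)
  show ?case
  proof (cases "r = 0")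
    case True
    then obtain m l' where "l = replicate m (j * N) @ l'"
       "l' = [] \<or> (\<exists>r l''. 0 < r \<and> r < N \<and> l' = (j * N + r) # l'' \<and> successively (gap_step N) l')"
      using Cons r by auto
    then show ?thesis using r True by (intro exI[of _ "Suc m"] exI[of _ l']) simp
  next
    case False
    then show ?thesis using r Cons.prems by (intro exI[of _ 0] exI[of _ "x # l"]) auto
  qed
qed simp

text \<open>
  The multiples of \<open>N\<close> between two non-multiples are all equal, since a step between multiples is
  less than \<open>N\<close>. From the last of them, as from the non-multiple itself, the next non-multiple is
  determined by its residue.
\<close>

lemma successively_nonmultiple_split:
  assumes "0 < s" "s < N" "successively (gap_step N) ((q * N + s) # l)"
  obtains (no_residue) m where "l = replicate m (Suc q * N)"
  | (residue) m r l' q' where "0 < r" "r < N" "q' = (if r \<le> s \<or> 0 < m then Suc q else q)"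
      "l = replicate m (Suc q * N) @ (q' * N + r) # l'"
      "successively (gap_step N) ((q' * N + r) # l')"
proof (cases l)
  case Nil
  then show ?thesis using no_residue[of 0] by simp
next
  case (Cons x l1)
  then have "gap_step N (q * N + s) x" using assms by simp
  then consider "x = Suc q * N"
    | r where "0 < r" "r < N" "x = (if r \<le> s then Suc q else q) * N + r"
    using assms by (auto simp: gap_step_from_nonmultiple)
  then show ?thesis
  proof cases
    case 1
    obtain m l' where "l1 = replicate m (Suc q * N) @ l'"
       "l' = [] \<or> (\<exists>r l''. 0 < r \<and> r < N \<and> l' = (Suc q * N + r) # l'' \<and> successively (gap_step N) l')"
      using successively_multiple_split[of N "Suc q" l1] Cons assms 1 by auto
    then show ?thesis
      using no_residue[of "Suc m"] residue[of _ "Suc q" "Suc m"] Cons 1 by auto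
  next
    case 2
    then show ?thesis using residue[of r _ 0 l1] assms(3) Cons by simp
  qed
qed

lemma gap_list_chain:
  assumes "set rs \<subseteq> {0<..<N}" "0 < s" "s < N"
  shows "successively (gap_step N) ((q * N + s) # gap_list N q s rs ms)"
    and "residues N (gap_list N q s rs ms) = rs"
proof -
  have N: "0 < N" using assms by simp
  have "successively (gap_step N) ((q * N + s) # gap_list N q s rs ms) \<and>
     residues N (gap_list N q s rs ms) = rs"
    using assms
  proof (induction rs arbitrary: q s ms)
    case Nil
    have "successively (gap_step N) ((q * N + s) # replicate m (Suc q * N))" for m
      using Nil N successively_replicate_multiple[of N "Suc q" "m - 1" "[]"]
      by (cases m) (auto simp: gap_step_from_nonmultiple)
    then show ?case by (simp add: residues_def del: mult_Suc)
  next
    case (Cons r rs)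
    define q' where "q' = (if r \<le> s \<or> 0 < hd ms then Suc q else q)"
    define l where "l = gap_list N q' r rs (tl ms)"
    have r: "0 < r" "r < N" using Cons.prems by auto
    have IH: "successively (gap_step N) ((q' * N + r) # l)" "residues N l = rs"
      using Cons.IH[of r q' "tl ms"] Cons.prems by (auto simp: l_def)
    have eq: "gap_list N q s (r # rs) ms = replicate (hd ms) (Suc q * N) @ (q' * N + r) # l"
      by (simp add: q'_def l_def Let_def)
    have "successively (gap_step N) ((q * N + s) # replicate (hd ms) (Suc q * N) @ (q' * N + r) # l)"
    proof (cases "hd ms")
      case 0
      then show ?thesis
        using IH(1) r Cons.prems by (auto simp: q'_def gap_step_from_nonmultiple)
    next
      case (Suc m)
      then have "gap_step N (Suc q * N) (q' * N + r)"
        using N r unfolding gap_step_from_multiple[OF N] by (auto simp: q'_def)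
      then have "successively (gap_step N) (Suc q * N # replicate m (Suc q * N) @ (q' * N + r) # l)"
        using IH(1) unfolding successively_replicate_multiple[OF N] by simp
      moreover have "gap_step N (q * N + s) (Suc q * N)"
        using Cons.prems by (simp add: gap_step_from_nonmultiple)
      ultimately show ?thesis using Suc by simp
    qed
    moreover have "residues N (replicate (hd ms) (Suc q * N) @ (q' * N + r) # l) = r # rs"
      using IH(2) r by (simp add: residues_def dvd_eq_mod_eq_0 del: mult_Suc)
    ultimately show ?case unfolding eq by blast
  qed
  then show "successively (gap_step N) ((q * N + s) # gap_list N q s rs ms)"
    and "residues N (gap_list N q s rs ms) = rs" by auto
qed

lemma gap_list_surj:
  assumes "successively (gap_step N) ((q * N + s) # l)" "0 < s" "s < N"
  shows "\<exists>ms. length ms = Suc (length (residues N l)) \<and> gap_list N q s (residues N l) ms = l"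
  using assms
proof (induction l arbitrary: q s rule: length_induct)
  case (1 l)
  show ?case
  proof (rule successively_nonmultiple_split[OF 1(3,4,2)])
    fix m assume l: "l = replicate m (Suc q * N)"
    then have "residues N l = []" by (auto simp: residues_def)
    then show ?thesis using l by (intro exI[of _ "[m]"]) simp
  next
    fix m r l' q'
    assume h: "0 < r" "r < N" "q' = (if r \<le> s \<or> 0 < m then Suc q else q)"
      "l = replicate m (Suc q * N) @ (q' * N + r) # l'"
      "successively (gap_step N) ((q' * N + r) # l')"
    have "length l' < length l" by (simp add: h(4))
    then obtain ms where ms: "length ms = Suc (length (residues N l'))"
        "gap_list N q' r (residues N l') ms = l'"
      using 1(1) h(1,2,5) by blast
    have "residues N l = r # residues N l'"
      using h(1,2) unfolding h(4) by (simp add: residues_def dvd_eq_mod_eq_0 del: mult_Suc)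
    then show ?thesis
      using ms h(3,4) by (intro exI[of _ "m # ms"]) (simp add: Let_def)
  qed
qed

lemma replicate_append_inj:
  assumes "replicate m a @ x # xs = replicate m' a @ y # ys" "x \<noteq> a" "y \<noteq> a"
  shows "m = m' \<and> x = y \<and> xs = ys"
  using assms
proof (induction m arbitrary: m')
  case 0 then show ?case by (cases m') auto
next
  case (Suc m) then show ?case by (cases m') auto
qed

text \<open>
  The multiplicity of \<open>(q + 1) * N\<close> can be read off because the non-multiple that follows differs
  from it, and it determines the quotient of that non-multiple.
\<close>

lemma gap_list_inj:
  assumes "length ms = Suc (length rs)" "length ms' = Suc (length rs)" "set rs \<subseteq> {0<..<N}" "0 < N"
    "gap_list N q s rs ms = gap_list N q s rs ms'"
  shows "ms = ms'"
  using assms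
proof (induction rs arbitrary: q s ms ms')
  case Nil
  then show ?case by (cases ms; cases ms') (auto dest: arg_cong[of _ _ length])
next
  case (Cons r rs)
  obtain m ns m' ns' where ms: "ms = m # ns" "ms' = m' # ns'"
    using Cons.prems(1,2) by (cases ms; cases ms') auto
  have nm: "k * N + r \<noteq> Suc q * N" for k
  proof
    assume "k * N + r = Suc q * N"
    then have "(k * N + r) mod N = (Suc q * N) mod N" by (rule arg_cong)
    then show False using Cons.prems(3) by (simp del: mult_Suc)
  qed
  from Cons.prems(5) have m: "m = m'" and eq: "gap_list N (if r \<le> s \<or> 0 < m then Suc q else q) r rs ns =
      gap_list N (if r \<le> s \<or> 0 < m then Suc q else q) r rs ns'"
    unfolding ms Let_def gap_list.simps list.sel
    by (drule_tac replicate_append_inj[OF _ nm nm]; simp)+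
  have "ns = ns'" using Cons.prems ms by (intro Cons.IH[OF _ _ _ _ eq]) auto
  then show ?case using m ms by simp
qed

section \<open>From multiplicities to columns\<close>

text \<open>
  Here \<open>m\<close> is the multiplicity at a gap above quotient \<open>q\<close>, and \<open>cs\<close> records the gaps above it. The
  flag tells whether the quotient grows at the gap even without a multiple. If it grows, then \<open>cs\<close> has
  heights from \<open>q + 2\<close> on and \<open>m\<close> becomes the entry for height \<open>q + 1\<close>. If it does not grow, then \<open>cs\<close>
  already has heights from \<open>q + 1\<close> on, so that the greatest height gets the new entry 0. If it
  grows because of a multiple, one of the copies is traded, together with the raising of all later
  parts, for a column of the greatest height. The last two cases are told apart by whether the last
  entry vanishes.
\<close>

fun record_gap :: "bool \<Rightarrow> nat \<Rightarrow> nat list \<Rightarrow> nat list" where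
  "record_gap True m cs = m # cs"
| "record_gap False 0 cs = cs @ [0]"
| "record_gap False (Suc m) cs = m # butlast cs @ [Suc (last cs)]"

fun record_gaps :: "nat \<Rightarrow> nat list \<Rightarrow> nat list \<Rightarrow> nat list" where
  "record_gaps s [] ms = ms"
| "record_gaps s (r # rs) ms = record_gap (r \<le> s) (hd ms) (record_gaps r rs (tl ms))"

lemma length_record_gap: "cs \<noteq> [] \<Longrightarrow> length (record_gap a m cs) = Suc (length cs)"
  by (cases "(a, m, cs)" rule: record_gap.cases) auto

lemma length_record_gaps:
  "length ms = Suc (length rs) \<Longrightarrow> length (record_gaps s rs ms) = Suc (length rs)"
proof (induction rs arbitrary: s ms)
  case (Cons r rs)
  then have "length (record_gaps r rs (tl ms)) = Suc (length rs)" by simp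
  then show ?case
    by (subst record_gaps.simps, subst length_record_gap) auto
qed simp

lemma record_gap_inj:
  assumes "record_gap a m cs = record_gap a m' cs'" "cs \<noteq> []" "cs' \<noteq> []"
  shows "m = m' \<and> cs = cs'"
  using assms by (cases a; cases m; cases m'; cases cs rule: rev_cases; cases cs' rule: rev_cases)
    (auto simp flip: append_Cons)

text \<open>
  If the quotient does not grow by itself, a last entry 0 comes from \<open>m = 0\<close>, and a positive last
  entry from a positive \<open>m\<close>.
\<close>

lemma record_gap_surj:
  assumes "length ds = Suc (Suc n)"
  shows "\<exists>m cs. length cs = Suc n \<and> record_gap a m cs = ds"
proof (cases a)
  case True
  then show ?thesis using assms by (cases ds) auto
next
  case False
  obtain d es e where ds: "ds = d # es @ [e]"
    using assms by (cases ds; cases "tl ds" rule: rev_cases) auto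
  show ?thesis
  proof (cases e)
    case 0
    then show ?thesis using False ds assms
      by (intro exI[of _ 0] exI[of _ "d # es"]) auto
  next
    case (Suc e')
    then show ?thesis using False ds assms
      by (intro exI[of _ "Suc d"] exI[of _ "es @ [e']"]) auto
  qed
qed

lemma bij_betw_record_gaps:
  "bij_betw (record_gaps s rs) {ms. length ms = Suc (length rs)} {cs. length cs = Suc (length rs)}"
proof (induction rs arbitrary: s)
  case Nil
  then show ?case by (simp add: bij_betw_def inj_on_def)
next
  case (Cons r rs)
  show ?case
  proof (rule bij_betw_imageI)
    show "inj_on (record_gaps s (r # rs)) {ms. length ms = Suc (length (r # rs))}"
    proof (rule inj_onI; clarsimp)
      fix ms ms' :: "nat list"
      assume len: "length ms = Suc (Suc (length rs))" "length ms' = Suc (Suc (length rs))"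
        and eq: "record_gap (r \<le> s) (hd ms) (record_gaps r rs (tl ms)) =
          record_gap (r \<le> s) (hd ms') (record_gaps r rs (tl ms'))"
      have len': "length (record_gaps r rs (tl ms)) = Suc (length rs)"
        "length (record_gaps r rs (tl ms')) = Suc (length rs)"
        using len by (simp_all add: length_record_gaps)
      then have "hd ms = hd ms' \<and> record_gaps r rs (tl ms) = record_gaps r rs (tl ms')"
        by (intro record_gap_inj[OF eq]) auto
      moreover then have "tl ms = tl ms'"
        using bij_betw_imp_inj_on[OF Cons.IH[of r]] len unfolding inj_on_def by simp
      ultimately show "ms = ms'" using len by (intro list.expand) auto
    qed
    show "record_gaps s (r # rs) ` {ms. length ms = Suc (length (r # rs))}
        = {cs. length cs = Suc (length (r # rs))}"
    proof (intro equalityI subsetI)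
      fix ds assume "ds \<in> {cs :: nat list. length cs = Suc (length (r # rs))}"
      then obtain m cs where cs: "length cs = Suc (length rs)" "record_gap (r \<le> s) m cs = ds"
        using record_gap_surj[of ds "length rs" "r \<le> s"] by auto
      then have "cs \<in> record_gaps r rs ` {ms. length ms = Suc (length rs)}"
        unfolding bij_betw_imp_surj_on[OF Cons.IH[of r]] by simp
      then obtain ms where "length ms = Suc (length rs)" "record_gaps r rs ms = cs" by auto
      then show "ds \<in> record_gaps s (r # rs) ` {ms. length ms = Suc (length (r # rs))}"
        using cs by (intro image_eqI[of _ _ "m # ms"]) auto
    qed (use length_record_gaps[of _ "r # rs" s] in auto)
  qed
qed

text \<open>
  The trade in \<open>record_gap\<close> balances: at a gap where the quotient grows only because of a multiple,
  the constant \<open>least_sum N (Suc q) r rs\<close> exceeds \<open>least_sum N q r rs\<close> by \<open>N * length rs\<close>, the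
  non-multiple itself is larger by \<open>N\<close>, and the traded copy has value \<open>(q + 1) * N\<close>. Together this is
  \<open>N\<close> times the greatest height \<open>q + 2 + length rs\<close>.
\<close>

lemma sum_gap_list:
  "length ms = Suc (length rs) \<Longrightarrow>
    sum_list (gap_list N q s rs ms) = least_sum N q s rs + N * column_weight q (record_gaps s rs ms)"
proof (induction rs arbitrary: q s ms)
  case Nil
  then obtain m where "ms = [m]" by (cases ms) auto
  then show ?case by (simp add: sum_list_replicate algebra_simps)
next
  case (Cons r rs)
  obtain m ns where ms: "ms = m # ns" "length ns = Suc (length rs)"
    using Cons.prems by (cases ms) auto
  define cs where "cs = record_gaps r rs ns"
  have IH: "sum_list (gap_list N q r rs ns) = least_sum N q r rs + N * column_weight q cs" for q
    using Cons.IH ms by (simp add: cs_def)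
  have "length cs = Suc (length rs)" using ms length_record_gaps cs_def by simp
  then obtain cs' c where cs: "cs = cs' @ [c]" "length cs' = length rs"
    by (cases cs rule: rev_cases) auto
  have zero: "column_weight q (cs' @ [c, 0]) = column_weight q (cs' @ [c])"
    using column_weight_snoc[of q "cs' @ [c]" 0] by simp
  show ?case
  proof (cases "r \<le> s")
    case True
    then show ?thesis
      by (simp add: ms Let_def IH sum_list_replicate algebra_simps flip: cs_def)
  next
    case False
    then show ?thesis
      by (cases m) (simp_all add: ms Let_def IH sum_list_replicate cs zero column_weight_snoc
          least_sum_Suc algebra_simps flip: cs_def)
  qed
qed


section \<open>The bijection between the two families of lists\<close>

text \<open>
  The smallest part is less than \<open>N\<close> and hence equals its residue \<open>r\<close>; everything above it is
  encoded relative to quotient 0.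
\<close>

lemma bij_betw_gap_list:
  assumes "set (r # rs) \<subseteq> {0<..<N}"
  shows "bij_betw (\<lambda>ms. r # gap_list N 0 r rs ms) {ms. length ms = Suc (length rs)}
           {l \<in> gap_lists N. residues N l = r # rs}"
proof (rule bij_betw_imageI)
  have r: "0 < r" "r < N" "set rs \<subseteq> {0<..<N}" using assms by auto
  then have nd: "\<not> N dvd r" by (simp add: dvd_eq_mod_eq_0)
  show "inj_on (\<lambda>ms. r # gap_list N 0 r rs ms) {ms. length ms = Suc (length rs)}"
  proof (rule inj_onI)
    fix ms ms'
    assume "ms \<in> {ms. length ms = Suc (length rs)}" "ms' \<in> {ms. length ms = Suc (length rs)}"
      "r # gap_list N 0 r rs ms = r # gap_list N 0 r rs ms'"
    then show "ms = ms'" using r gap_list_inj[of ms rs ms' N 0 r] by simp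
  qed
  show "(\<lambda>ms. r # gap_list N 0 r rs ms) ` {ms. length ms = Suc (length rs)}
      = {l \<in> gap_lists N. residues N l = r # rs}"
  proof (intro equalityI subsetI)
    fix l assume "l \<in> (\<lambda>ms. r # gap_list N 0 r rs ms) ` {ms. length ms = Suc (length rs)}"
    then obtain ms where l: "l = r # gap_list N 0 r rs ms" by blast
    show "l \<in> {l \<in> gap_lists N. residues N l = r # rs}"
      using gap_list_chain[of rs N r 0 ms] r nd
      by (simp add: l gap_lists_def residues_def)
  next
    fix l assume l: "l \<in> {l \<in> gap_lists N. residues N l = r # rs}"
    then obtain x l' where x: "l = x # l'" by (cases l) (auto simp: residues_def)
    with l have "0 < x" "x < N" "successively (gap_step N) (x # l')" by (auto simp: gap_lists_def)
    moreover from this have "x = r" "residues N l' = rs"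
      using l x by (auto simp: residues_def split: if_splits dest: dvd_imp_le)
    ultimately obtain ms where "length ms = Suc (length rs)" "gap_list N 0 r rs ms = l'"
      using gap_list_surj[of N 0 r l'] by auto
    then show "l \<in> (\<lambda>ms. r # gap_list N 0 r rs ms) ` {ms. length ms = Suc (length rs)}"
      using x \<open>x = r\<close> by auto
  qed
qed

text \<open>
  For a fixed residue sequence both sides are parametrised by lists of \<open>length rs\<close> numbers,
  multiplicities on one side and column counts on the other, matched by \<open>record_gaps\<close>. The
  distinct list is built above 0 (quotient 0, residue 0): every residue exceeds 0, so the first
  quotient may be 0.
\<close>

lemma bij_betw_fixed_residues:
  assumes "0 < N" "set rs \<subseteq> {0<..<N}"
  shows "\<exists>f. bij_betw f {l \<in> gap_lists N. residues N l = rs} {l \<in> distinct_lists N. residues N l = rs} \<and>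
    (\<forall>l \<in> {l \<in> gap_lists N. residues N l = rs}. sum_list (f l) = sum_list l)"
proof (cases rs)
  case Nil
  have "l = []" if "l \<in> gap_lists N" "residues N l = []" for l
    using that by (cases l) (auto simp: gap_lists_def residues_def split: if_splits dest: dvd_imp_le)
  moreover have "l = []" if "l \<in> distinct_lists N" "residues N l = []" for l
    using that by (cases l) (auto simp: distinct_lists_def residues_def)
  ultimately have "{l \<in> gap_lists N. residues N l = rs} = {[]}"
    "{l \<in> distinct_lists N. residues N l = rs} = {[]}"
    unfolding Nil by (auto simp: gap_lists_def distinct_lists_def residues_def)
  then show ?thesis by (intro exI[of _ id]) simp
next
  case (Cons r rs')
  show ?thesis
  proof (rule bij_betw_match)
    show "bij_betw (\<lambda>ms. r # gap_list N 0 r rs' ms) {ms. length ms = Suc (length rs')}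
        {l \<in> gap_lists N. residues N l = rs}"
      using bij_betw_gap_list assms(2) unfolding Cons .
    show "bij_betw (distinct_list N 0 0 rs \<circ> record_gaps r rs') {ms. length ms = Suc (length rs')}
        {l \<in> distinct_lists N. residues N l = rs}"
      using bij_betw_record_gaps[of r rs'] bij_betw_distinct_list[OF assms(2,1)]
      by (intro bij_betw_trans) (auto simp: Cons)
    fix ms :: "nat list" assume "ms \<in> {ms. length ms = Suc (length rs')}"
    then show "sum_list ((distinct_list N 0 0 rs \<circ> record_gaps r rs') ms)
        = sum_list (r # gap_list N 0 r rs' ms)"
      using assms(2) sum_gap_list[of ms rs' N 0 r] length_record_gaps[of ms rs' r]
        sum_distinct_list[of "record_gaps r rs' ms" rs N 0 0]
      by (simp add: Cons)
  qed
qed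

text \<open>
  Andrews-Olsson, refined by the residue sequence. Since the sequence is preserved, any restriction
  on the residues can be imposed on both sides afterwards.
\<close>

theorem bij_betw_gap_distinct_lists:
  assumes "0 < N"
  shows "\<exists>f. bij_betw f (gap_lists N) (distinct_lists N) \<and>
    (\<forall>l \<in> gap_lists N. sum_list (f l) = sum_list l \<and> residues N (f l) = residues N l)"
proof -
  define G where "G rs = {l \<in> gap_lists N. residues N l = rs}" for rs
  define D where "D rs = {l \<in> distinct_lists N. residues N l = rs}" for rs
  have res: "set (residues N l) \<subseteq> {0<..<N}" for l
    using assms by (auto simp: residues_def dvd_eq_mod_eq_0)
  have "\<exists>f. \<forall>rs. set rs \<subseteq> {0<..<N} \<longrightarrow>
      bij_betw (f rs) (G rs) (D rs) \<and> (\<forall>l\<in>G rs. sum_list (f rs l) = sum_list l)"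
    unfolding G_def D_def using bij_betw_fixed_residues[OF assms] by (intro choice) blast
  then obtain f where f: "set rs \<subseteq> {0<..<N} \<Longrightarrow> bij_betw (f rs) (G rs) (D rs)"
      "set rs \<subseteq> {0<..<N} \<Longrightarrow> l \<in> G rs \<Longrightarrow> sum_list (f rs l) = sum_list l" for rs l
    by blast
  \<comment> \<open>The fibres over the residue sequences are matched separately and glued.\<close>
  define F where "F l = f (residues N l) l" for l
  have F: "F l \<in> distinct_lists N" "residues N (F l) = residues N l" "sum_list (F l) = sum_list l"
    if "l \<in> gap_lists N" for l
  proof -
    have l: "l \<in> G (residues N l)" using that by (simp add: G_def)
    then have "F l \<in> D (residues N l)" using f(1)[OF res] by (auto simp: F_def bij_betw_def)
    then show "F l \<in> distinct_lists N" "residues N (F l) = residues N l" by (auto simp: D_def)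
    show "sum_list (F l) = sum_list l" using f(2)[OF res l] by (simp add: F_def)
  qed
  have "inj_on F (gap_lists N)"
  proof (rule inj_onI)
    fix l l' assume l: "l \<in> gap_lists N" "l' \<in> gap_lists N" "F l = F l'"
    then have "residues N l = residues N l'" using F(2) by metis
    then show "l = l'"
      using l inj_onD[OF bij_betw_imp_inj_on[OF f(1)[OF res[of l]]], of l l'] by (simp add: F_def G_def)
  qed
  moreover have "l \<in> F ` gap_lists N" if "l \<in> distinct_lists N" for l
  proof -
    have "l \<in> f (residues N l) ` G (residues N l)"
      using that unfolding bij_betw_imp_surj_on[OF f(1)[OF res]] by (simp add: D_def)
    then obtain l' where "l' \<in> gap_lists N" "residues N l' = residues N l" "l = f (residues N l) l'"
      by (auto simp: G_def)
    then show ?thesis by (intro image_eqI[of _ _ l']) (simp_all add: F_def)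
  qed
  ultimately have "bij_betw F (gap_lists N) (distinct_lists N)"
    using F(1) by (intro bij_betw_imageI) auto
  then show ?thesis using F by blast
qed

section \<open>Plain partitions as lists\<close>

lemma val_simps [simp]: "val (plain x) = x" "val (over x) = x" "val (0 :: cnum) = 0"
  "val (scale k p) = k * val p" "val (p + q) = val p + val q"
  by (transfer; simp)+

lemma plain_eq_iff [simp]: "plain x = plain y \<longleftrightarrow> x = y" "plain x = 0 \<longleftrightarrow> x = 0"
  by (transfer; simp)+

lemma col_plain [simp]: "col (plain x) = 0" "col (0 :: cnum) = 0"
  by (transfer; simp)+

lemma plain_le_iff [simp]: "plain x \<le> plain y \<longleftrightarrow> x \<le> y" "plain x < plain y \<longleftrightarrow> x < y"
  by (auto simp: less_eq_cnum_def less_cnum_def)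

lemma plain_minus: "plain x - plain y = plain (x - y)"
  by transfer auto

lemma over_eq_plain_iff: "over x = plain y \<longleftrightarrow> x = 0 \<and> y = 0"
  by transfer auto

lemma zero_in_range_plain: "0 \<in> range plain"
  by (metis plain_eq_iff(2) rangeI)

lemma zero_le_cnum: "0 \<le> (p :: cnum)"
  unfolding less_eq_cnum_def by transfer auto

definition increasing_lists :: "nat list set" where
  "increasing_lists = {l. successively (\<le>) l \<and> 0 \<notin> set l}"

text \<open>
  Increasing lists start with the smallest part, two-colored partitions with the largest, hence the
  reversal.
\<close>

definition of_list :: "nat list \<Rightarrow> nat \<Rightarrow> cnum" where
  "of_list l = (\<lambda>j. if j < length l then plain (rev l ! j) else 0)"

lemma of_list_eq_0_iff:
  assumes "0 \<notin> set l"
  shows "of_list l j = 0 \<longleftrightarrow> length l \<le> j"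
proof (cases "j < length l")
  case True
  then have "rev l ! j \<in> set (rev l)" by (intro nth_mem) simp
  then have "rev l ! j \<noteq> 0" using assms by (metis set_rev)
  then show ?thesis using True by (simp add: of_list_def)
qed (simp add: of_list_def)

text \<open>
  Turns conditions on successive parts, including those on repeated parts, into conditions on
  neighbours in the list.
\<close>

lemma adjacent_of_list_iff:
  assumes "0 \<notin> set l"
  shows "(\<forall>j. of_list l (Suc j) \<noteq> 0 \<longrightarrow> R (of_list l (Suc j)) (of_list l j)) \<longleftrightarrow>
    successively (\<lambda>a b. R (plain a) (plain b)) l"
proof -
  have "successively (\<lambda>a b. R (plain a) (plain b)) l \<longleftrightarrow>
      successively (\<lambda>a b. R (plain b) (plain a)) (rev l)" by simp
  also have "\<dots> \<longleftrightarrow> (\<forall>j. Suc j < length l \<longrightarrow> R (of_list l (Suc j)) (of_list l j))"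
    unfolding successively_conv_nth by (auto simp: of_list_def)
  also have "\<dots> \<longleftrightarrow> (\<forall>j. of_list l (Suc j) \<noteq> 0 \<longrightarrow> R (of_list l (Suc j)) (of_list l j))"
    using of_list_eq_0_iff[OF assms] by (simp add: not_le)
  finally show ?thesis by simp
qed

lemma parts_of_list:
  assumes "0 \<notin> set l"
  shows "parts (of_list l) = plain ` set l"
proof -
  have "parts (of_list l) = of_list l ` {j. of_list l j \<noteq> 0}"
    by (auto simp: parts_def)
  also have "{j. of_list l j \<noteq> 0} = {..<length l}"
    by (simp only: of_list_eq_0_iff[OF assms] not_le lessThan_def)
  also have "of_list l ` {..<length l} = plain ` (\<lambda>j. rev l ! j) ` {..<length l}"
    unfolding image_image by (rule image_cong) (simp_all add: of_list_def)
  also have "(\<lambda>j. rev l ! j) ` {..<length l} = set l"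
    using set_conv_nth[of "rev l"] by auto
  finally show ?thesis .
qed

lemma size_of_list:
  assumes "0 \<notin> set l"
  shows "(\<Sum>j | of_list l j \<noteq> 0. val (of_list l j)) = sum_list l"
proof -
  have "(\<Sum>j | of_list l j \<noteq> 0. val (of_list l j)) = (\<Sum>j<length l. rev l ! j)"
    by (rule sum.cong) (simp_all add: of_list_eq_0_iff[OF assms] not_le lessThan_def, simp add: of_list_def)
  also have "\<dots> = sum_list l"
    using sum_list_sum_nth[of "rev l"] by (simp add: atLeast0LessThan)
  finally show ?thesis .
qed

lemma inj_on_of_list: "inj_on of_list {l. 0 \<notin> set l}"
proof (rule inj_onI)
  fix l l' assume "l \<in> {l. 0 \<notin> set l}" "l' \<in> {l. 0 \<notin> set l}" and eq: "of_list l = of_list l'"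
  then have len: "length l = length l'"
    using of_list_eq_0_iff[of l] of_list_eq_0_iff[of l'] by (metis le_refl le_antisym mem_Collect_eq)
  have "rev l ! j = rev l' ! j" if "j < length l" for j
    using fun_cong[OF eq, of j] that len by (simp add: of_list_def)
  then have "rev l = rev l'" using len by (intro nth_equalityI) auto
  then show "l = l'" by simp
qed

lemma two_colored_partition_of_list:
  assumes "l \<in> increasing_lists"
  shows "two_colored_partition (of_list l)"
proof -
  have nz: "0 \<notin> set l" and sorted: "successively (\<lambda>a b. plain a \<le> plain b) l"
    using assms by (auto simp: increasing_lists_def)
  have "{j. of_list l j \<noteq> 0} = {..<length l}"
    by (simp only: of_list_eq_0_iff[OF nz] not_le lessThan_def)
  moreover have "of_list l (Suc j) \<le> of_list l j" for j
    using sorted zero_le_cnum unfolding adjacent_of_list_iff[OF nz, of "(\<le>)", symmetric] by metis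
  ultimately show ?thesis by (simp add: two_colored_partition_def)
qed

lemma plain_partition_is_of_list:
  assumes "two_colored_partition \<mu>" "range \<mu> \<subseteq> range plain"
  shows "\<mu> \<in> of_list ` increasing_lists"
proof -
  have mono: "\<mu> j \<le> \<mu> i" if "i \<le> j" for i j
    using assms(1) that unfolding two_colored_partition_def by (blast intro: lift_Suc_antimono_le)
  have "{i. \<mu> i \<noteq> 0} \<noteq> UNIV"
    using assms(1) infinite_UNIV_nat unfolding two_colored_partition_def by metis
  then have ex: "\<exists>n. \<mu> n = 0" by auto
  define n where "n = (LEAST n. \<mu> n = 0)"
  have zero: "\<mu> j = 0" if "n \<le> j" for j
    using mono[OF that] LeastI_ex[OF ex] zero_le_cnum[of "\<mu> j"] by (simp add: n_def)
  have nonzero: "\<mu> j \<noteq> 0" if "j < n" for j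
    using not_less_Least that by (auto simp: n_def)
  have plain: "\<mu> j = plain (val (\<mu> j))" for j
    using assms(2) by (metis rangeE range_subsetD val_simps(1))
  define l where "l = rev (map (val \<circ> \<mu>) [0..<n])"
  have "of_list l = \<mu>"
    using zero plain by (auto simp: of_list_def l_def fun_eq_iff)
  moreover have "l \<in> increasing_lists"
  proof -
    have "0 \<notin> set l" using nonzero plain by (auto simp: l_def) (metis plain_eq_iff(2))
    moreover have "val (\<mu> (Suc j)) \<le> val (\<mu> j)" for j
      using mono[of j "Suc j"] by (auto simp: less_eq_cnum_def)
    then have "successively (\<le>) l"
      unfolding l_def successively_rev by (simp add: successively_conv_nth)
    ultimately show ?thesis by (simp add: increasing_lists_def)
  qed
  ultimately show ?thesis by blast
qed

lemma gap_lists_increasing: "l \<in> gap_lists N \<Longrightarrow> l \<in> increasing_lists"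
proof -
  assume l: "l \<in> gap_lists N"
  then have le: "successively (\<le>) l"
    by (auto simp: gap_lists_def gap_step_def elim: successively_mono)
  then have "sorted l" by (simp add: successively_conv_sorted_wrt)
  then have "0 \<notin> set l" using l by (cases l) (auto simp: gap_lists_def)
  with le show ?thesis by (simp add: increasing_lists_def)
qed

lemma distinct_lists_increasing: "l \<in> distinct_lists N \<Longrightarrow> l \<in> increasing_lists"
  by (auto simp: distinct_lists_def increasing_lists_def elim: successively_mono)

lemma Min_parts_of_list:
  assumes "l \<in> increasing_lists"
  shows "(parts (of_list l) \<noteq> {} \<longrightarrow> Min (parts (of_list l)) < plain u) \<longleftrightarrow> (l \<noteq> [] \<longrightarrow> hd l < u)"
proof (cases l)
  case Nil
  then show ?thesis using assms by (simp add: increasing_lists_def parts_of_list)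
next
  case (Cons a l')
  have "sorted l" using assms by (simp add: increasing_lists_def successively_conv_sorted_wrt)
  then have "Min (plain ` set l) = plain a" using Cons by (intro Min_eqI) auto
  then show ?thesis using assms Cons by (simp add: increasing_lists_def parts_of_list)
qed

text \<open>
  To identify a set of partitions without overlined parts with a set of lists, it suffices to
  compare membership.
\<close>

lemma bij_betw_of_list:
  assumes "\<And>\<mu>. \<mu> \<in> A \<Longrightarrow> two_colored_partition \<mu> \<and> range \<mu> \<subseteq> range plain"
    and "\<And>l. l \<in> increasing_lists \<Longrightarrow> of_list l \<in> A \<longleftrightarrow> l \<in> L"
    and "L \<subseteq> increasing_lists"
  shows "bij_betw of_list L A"
proof (rule bij_betw_imageI)
  show "inj_on of_list L"
    using inj_on_of_list by (rule inj_on_subset) (use assms(3) in \<open>auto simp: increasing_lists_def\<close>)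
  have "\<mu> \<in> of_list ` L" if "\<mu> \<in> A" for \<mu>
    using plain_partition_is_of_list[of \<mu>] assms(1,2) that by blast
  then show "of_list ` L = A" using assms(2,3) by blast
qed


section \<open>The two restricted families of two-colored partitions\<close>

text \<open>
  With these facts the types are treated uniformly: \<open>z3\<close> divides the values of all admitted
  overlined numbers and of all repeatable numbers, and a number divisible by
  \<open>u\<close> is congruent to 0 modulo \<open>v\<close>.
\<close>

lemma level1_pair_dvd:
  assumes "level1_pair t i"
  shows "z3_of t i dvd z1_of t i" "z3_of t i dvd z2_of t i"
    "z3_of t i dvd v_of t i" "v_of t i dvd u_of t i" "0 < u_of t i"
proof -
  have "2 * n - 2 = 2 * (n - 1)" "2 * n + 2 = 2 * (n + 1)" for n :: nat by simp_all
  then have "z3_of t i dvd z1_of t i \<and> z3_of t i dvd z2_of t i \<and>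
    z3_of t i dvd v_of t i \<and> v_of t i dvd u_of t i \<and> 0 < u_of t i"
    using assms by (cases t) (auto simp del: mult_Suc_right)
  then show "z3_of t i dvd z1_of t i" "z3_of t i dvd z2_of t i"
    "z3_of t i dvd v_of t i" "v_of t i dvd u_of t i" "0 < u_of t i" by auto
qed

lemma multiple_of_plain: "multiple_of u (plain x) \<longleftrightarrow> u dvd x"
  unfolding multiple_of_def dvd_def by (auto simp: cnum_eq_iff) (transfer; auto)+

lemma val_Z_repeatable:
  assumes "level1_pair t i" "p \<in> Z_repeatable t i"
  shows "z3_of t i dvd val p"
  using assms(2) level1_pair_dvd[OF assms(1)] by (auto simp: Z_repeatable_def Let_def)

lemma plain_in_Z_repeatable:
  assumes "z3_of t i dvd x"
  shows "plain x \<in> Z_repeatable t i"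
proof -
  from assms obtain k where "plain x = scale k (plain (z3_of t i))"
    using multiple_of_plain unfolding multiple_of_def by blast
  then show ?thesis by (auto simp: Z_repeatable_def Let_def)
qed

lemma Z_allowed_cases:
  assumes "level1_pair t i" "p \<in> Z_allowed t i" "\<not> z3_of t i dvd val p"
  shows "p \<in> range plain"
  using assms(2,3) level1_pair_dvd[OF assms(1)] by (auto simp: Z_allowed_def Let_def)

lemma repeated_parts_subset_iff:
  "repeated_parts \<mu> \<subseteq> Z \<longleftrightarrow> (\<forall>j. \<mu> (Suc j) \<noteq> 0 \<longrightarrow> \<mu> (Suc j) = \<mu> j \<longrightarrow> \<mu> (Suc j) \<in> Z)"
proof -
  have "p \<in> repeated_parts \<mu> \<longleftrightarrow> (\<exists>j. \<mu> (Suc j) = p \<and> \<mu> j = p \<and> p \<noteq> 0)" for p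
    unfolding repeated_parts_def parts_def by blast
  then show ?thesis unfolding subset_iff by metis
qed

context
  fixes t :: affine_type and i :: nat and X :: "nat set"
  assumes pair: "level1_pair t i" and X: "X \<subseteq> {1..<z3_of t i}"
begin

lemma cong_to_some_iff: "cong_to_some t i X p \<longleftrightarrow> val p mod z3_of t i \<in> X"
proof -
  have "[val p = x] (mod z3_of t i) \<longleftrightarrow> val p mod z3_of t i = x" if "x \<in> X" for x
  proof -
    have "x < z3_of t i" using X that by auto
    then show ?thesis by (simp add: cong_def)
  qed
  then show ?thesis unfolding cong_to_some_def by blast
qed

lemma mod_z3_in_X_imp_not_dvd: "x mod z3_of t i \<in> X \<Longrightarrow> \<not> z3_of t i dvd x"
  using X by (auto simp: dvd_eq_mod_eq_0)

lemma z3_dvd_u: "z3_of t i dvd u_of t i"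
  using level1_pair_dvd[OF pair] dvd_trans by blast

lemma set_residues_subset_iff:
  "set (residues (u_of t i) l) \<subseteq> {r. r mod z3_of t i \<in> X} \<longleftrightarrow>
    (\<forall>x\<in>set l. u_of t i dvd x \<or> x mod z3_of t i \<in> X)"
  using z3_dvd_u by (auto simp: residues_def mod_mod_cancel)

text \<open>
  A part that is not a multiple of \<open>u\<close> has a residue in \<open>X\<close>, so \<open>z3\<close> does not divide its value, which
  excludes the overlined numbers.
\<close>

lemma restricted_partition_is_plain:
  assumes "\<mu> \<in> Z_set t i" "\<forall>p\<in>parts \<mu>. multiple_of (u_of t i) p \<or> cong_to_some t i X p"
  shows "two_colored_partition \<mu> \<and> range \<mu> \<subseteq> range plain"
proof
  show "two_colored_partition \<mu>" using assms(1) by (simp add: Z_set_def)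
  have "p \<in> range plain" if "p \<in> range \<mu>" for p
  proof (cases "p = 0")
    case True
    then show ?thesis using zero_in_range_plain by simp
  next
    case False
    then have "p \<in> parts \<mu>" using that by (simp add: parts_def)
    then consider "multiple_of (u_of t i) p" | "cong_to_some t i X p" using assms(2) by blast
    then show ?thesis
    proof cases
      case 1
      then obtain k where "p = scale k (plain (u_of t i))" by (auto simp: multiple_of_def)
      then have "p = plain (k * u_of t i)" by (simp add: cnum_eq_iff) (transfer; auto)
      then show ?thesis by blast
    next
      case 2
      then show ?thesis
        using Z_allowed_cases[OF pair, of p] mod_z3_in_X_imp_not_dvd assms(1) that
        by (auto simp: cong_to_some_iff Z_set_def)
    qed
  qed
  then show "range \<mu> \<subseteq> range plain" by blast
qed

lemma of_list_in_Z_set_iff: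
  assumes "l \<in> increasing_lists"
  shows "of_list l \<in> Z_set t i \<longleftrightarrow> repeated_parts (of_list l) \<subseteq> Z_repeatable t i"
proof -
  have "range (of_list l) \<subseteq> range plain"
    using zero_in_range_plain by (auto simp: of_list_def)
  then have "range (of_list l) \<subseteq> Z_allowed t i" by (auto simp: Z_allowed_def Let_def)
  moreover have "over x \<notin> parts (of_list l)" if "1 \<le> x" for x
    using that assms by (auto simp: increasing_lists_def parts_of_list over_eq_plain_iff)
  ultimately show ?thesis
    using two_colored_partition_of_list[OF assms] by (auto simp: Z_set_def)
qed

text \<open>
  A special number is divisible by \<open>z3\<close>, because \<open>z3\<close> divides \<open>v\<close>; among the parts that can occur,
  only the multiples of \<open>u\<close> are.
\<close>

lemma cong_special_plain_iff:
  assumes "u_of t i dvd x \<or> x mod z3_of t i \<in> X"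
  shows "cong_special t i (plain x) \<longleftrightarrow> u_of t i dvd x"
proof
  assume "cong_special t i (plain x)"
  then have "[x = z3_of t i] (mod v_of t i) \<or> [x = 0] (mod v_of t i)"
    by (auto simp: cong_special_def)
  then have "[x = z3_of t i] (mod z3_of t i) \<or> [x = 0] (mod z3_of t i)"
    using level1_pair_dvd(3)[OF pair] cong_dvd_modulus_nat by blast
  then have "z3_of t i dvd x" by (auto simp: cong_def)
  then show "u_of t i dvd x" using assms mod_z3_in_X_imp_not_dvd by blast
next
  assume "u_of t i dvd x"
  then have "[x = 0] (mod v_of t i)"
    using level1_pair_dvd(4)[OF pair] by (meson cong_0_iff dvd_trans)
  then show "cong_special t i (plain x)" by (auto simp: cong_special_def)
qed

lemma plain_in_Z_repeatable_iff:
  assumes "u_of t i dvd x \<or> x mod z3_of t i \<in> X"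
  shows "plain x \<in> Z_repeatable t i \<longleftrightarrow> u_of t i dvd x"
proof
  assume "plain x \<in> Z_repeatable t i"
  then have "z3_of t i dvd x" using val_Z_repeatable[OF pair, of "plain x"] by simp
  then show "u_of t i dvd x" using assms mod_z3_in_X_imp_not_dvd by blast
next
  assume "u_of t i dvd x"
  with z3_dvd_u have "z3_of t i dvd x" by (rule dvd_trans)
  then show "plain x \<in> Z_repeatable t i" by (rule plain_in_Z_repeatable)
qed

text \<open>
  On the parts that can occur, being special and being repeatable both mean divisibility by \<open>u\<close>, so
  the conditions on successive parts become \<open>gap_step\<close>.
\<close>

lemma of_list_in_AO1_res_iff:
  assumes "l \<in> increasing_lists"
  shows "of_list l \<in> AO1_res t i X \<longleftrightarrow>
    l \<in> gap_lists (u_of t i) \<and> set (residues (u_of t i) l) \<subseteq> {r. r mod z3_of t i \<in> X}"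
proof (cases "\<forall>x\<in>set l. u_of t i dvd x \<or> x mod z3_of t i \<in> X")
  case True
  define u where "u = u_of t i"
  define R where "R a b \<longleftrightarrow> (a = b \<longrightarrow> a \<in> Z_repeatable t i) \<and> b - a \<le> plain u \<and>
      (cong_special t i b \<or> cong_special t i a \<longrightarrow> b - a < plain u)" for a b
  have nz: "0 \<notin> set l" using assms by (simp add: increasing_lists_def)
  have "of_list l \<in> AO1_res t i X \<longleftrightarrow> of_list l \<in> AO1 t i"
    using True by (simp add: AO1_res_def parts_of_list[OF nz] multiple_of_plain cong_to_some_iff)
  also have "\<dots> \<longleftrightarrow> (\<forall>j. of_list l (Suc j) \<noteq> 0 \<longrightarrow> R (of_list l (Suc j)) (of_list l j)) \<and>
      (l \<noteq> [] \<longrightarrow> hd l < u)"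
    unfolding AO1_def of_list_in_Z_set_iff[OF assms] mem_Collect_eq Let_def repeated_parts_subset_iff
      Min_parts_of_list[OF assms] R_def u_def by blast
  also have "\<dots> \<longleftrightarrow> successively (\<lambda>a b. R (plain a) (plain b)) l \<and> (l \<noteq> [] \<longrightarrow> hd l < u)"
    unfolding adjacent_of_list_iff[OF nz] ..
  also have "successively (\<lambda>a b. R (plain a) (plain b)) l \<longleftrightarrow> successively (gap_step u) l"
  proof -
    have le: "l ! j \<le> l ! Suc j" if "Suc j < length l" for j
      using assms that by (simp add: increasing_lists_def successively_conv_nth)
    have "R (plain (l ! j)) (plain (l ! Suc j)) \<longleftrightarrow> gap_step u (l ! j) (l ! Suc j)"
      if "Suc j < length l" for j
    proof -
      define a b where "a = l ! j" and "b = l ! Suc j"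
      have "a \<le> b" using le[OF that] by (simp add: a_def b_def)
      have "a \<in> set l" "b \<in> set l" using that by (simp_all add: a_def b_def)
      then have x: "u_of t i dvd a \<or> a mod z3_of t i \<in> X" "u_of t i dvd b \<or> b mod z3_of t i \<in> X"
        using True by blast+
      have diff: "b - a \<le> u_of t i \<longleftrightarrow> b \<le> a + u_of t i" "b - a < u_of t i \<longleftrightarrow> b < a + u_of t i"
        using \<open>a \<le> b\<close> by auto
      have "R (plain a) (plain b) \<longleftrightarrow> gap_step u a b"
        unfolding R_def gap_step_def plain_minus plain_le_iff plain_eq_iff diff u_def
          cong_special_plain_iff[OF x(1)] cong_special_plain_iff[OF x(2)]
          plain_in_Z_repeatable_iff[OF x(1)]
        using \<open>a \<le> b\<close> by blast
      then show ?thesis by (simp add: a_def b_def)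
    qed
    then show ?thesis unfolding successively_conv_nth by blast
  qed
  also have "successively (gap_step u) l \<and> (l \<noteq> [] \<longrightarrow> hd l < u) \<longleftrightarrow> l \<in> gap_lists u"
    using nz by (cases l) (auto simp: gap_lists_def)
  finally show ?thesis using True by (simp add: set_residues_subset_iff u_def)
next
  case False
  then show ?thesis
    using assms unfolding set_residues_subset_iff
    by (auto simp: AO1_res_def increasing_lists_def parts_of_list multiple_of_plain cong_to_some_iff)
qed

text \<open>
  No part is divisible by \<open>z3\<close>, hence none is repeatable; the parts are then distinct and not
  divisible by \<open>u\<close>, which gives the condition of every type.
\<close>

lemma of_list_in_AO2_res_iff:
  assumes "l \<in> increasing_lists"
  shows "of_list l \<in> AO2_res t i X \<longleftrightarrow>
    l \<in> distinct_lists (u_of t i) \<and> set (residues (u_of t i) l) \<subseteq> {r. r mod z3_of t i \<in> X}"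
proof (cases "\<forall>x\<in>set l. x mod z3_of t i \<in> X")
  case True
  have nz: "0 \<notin> set l" and le: "successively (\<le>) l" using assms by (auto simp: increasing_lists_def)
  have z3: "\<not> z3_of t i dvd x" if "x \<in> set l" for x
    using True that mod_z3_in_X_imp_not_dvd by blast
  then have u: "\<not> u_of t i dvd x" if "x \<in> set l" for x
    using that z3_dvd_u dvd_trans by blast
  have "p \<notin> Z_repeatable t i" if p: "p \<in> parts (of_list l)" for p
  proof -
    obtain x where "x \<in> set l" "p = plain x" using p by (auto simp: parts_of_list[OF nz])
    then show ?thesis using z3 val_Z_repeatable[OF pair, of p] by auto
  qed
  then have rep: "repeated_parts (of_list l) \<subseteq> Z_repeatable t i \<longleftrightarrow> repeated_parts (of_list l) = {}"
    by (auto simp: repeated_parts_def)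
  have "AO2_condition t i (of_list l)" if "repeated_parts (of_list l) = {}"
    using that u by (cases t) (auto simp: parts_of_list[OF nz] multiple_of_plain)
  then have "of_list l \<in> AO2_res t i X \<longleftrightarrow> repeated_parts (of_list l) \<subseteq> {}"
    using True rep
    by (auto simp: AO2_res_def AO2_def of_list_in_Z_set_iff[OF assms] parts_of_list[OF nz] cong_to_some_iff)
  also have "\<dots> \<longleftrightarrow> successively (\<lambda>a b. a \<noteq> b) l"
    unfolding repeated_parts_subset_iff using adjacent_of_list_iff[OF nz, of "(\<noteq>)"] by simp
  also have "\<dots> \<longleftrightarrow> successively (<) l"
    using le unfolding successively_conv_nth by (auto simp: order.order_iff_strict)
  also have "\<dots> \<longleftrightarrow> l \<in> distinct_lists (u_of t i)"
    using u by (auto simp: distinct_lists_def)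
  finally show ?thesis using True by (simp add: set_residues_subset_iff)
next
  case False
  then show ?thesis
    using assms unfolding set_residues_subset_iff
    by (auto simp: AO2_res_def increasing_lists_def parts_of_list cong_to_some_iff distinct_lists_def)
qed

lemma bij_betw_of_list_AO1_res:
  "bij_betw of_list {l \<in> gap_lists (u_of t i). set (residues (u_of t i) l) \<subseteq> {r. r mod z3_of t i \<in> X}}
     (AO1_res t i X)"
proof (rule bij_betw_of_list)
  show "two_colored_partition \<mu> \<and> range \<mu> \<subseteq> range plain" if "\<mu> \<in> AO1_res t i X" for \<mu>
    using that by (intro restricted_partition_is_plain) (auto simp: AO1_res_def AO1_def)
qed (use of_list_in_AO1_res_iff gap_lists_increasing in auto)

lemma bij_betw_of_list_AO2_res:
  "bij_betw of_list {l \<in> distinct_lists (u_of t i). set (residues (u_of t i) l) \<subseteq> {r. r mod z3_of t i \<in> X}}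
     (AO2_res t i X)"
proof (rule bij_betw_of_list)
  show "two_colored_partition \<mu> \<and> range \<mu> \<subseteq> range plain" if "\<mu> \<in> AO2_res t i X" for \<mu>
    using that by (intro restricted_partition_is_plain) (auto simp: AO2_res_def AO2_def)
qed (use of_list_in_AO2_res_iff distinct_lists_increasing in auto)

end

theorem corollary4p17:
  fixes t :: affine_type and i :: nat and X :: "nat set"
  assumes "level1_pair t i"
    and "X \<subseteq> {1..<z3_of t i}"
  shows "\<forall>m. \<exists>f. bij_betw f (of_size (AO1_res t i X) m) (of_size (AO2_res t i X) m)"
proof
  fix m
  define u where "u = u_of t i"
  define S where "S = {r. r mod z3_of t i \<in> X}"
  define size where "size \<mu> = (\<Sum>j | \<mu> j \<noteq> 0. val (\<mu> j))" for \<mu> :: "nat \<Rightarrow> cnum"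
  define G where "G = {l \<in> gap_lists u. set (residues u l) \<subseteq> S}"
  define D where "D = {l \<in> distinct_lists u. set (residues u l) \<subseteq> S}"
  obtain F where F: "bij_betw F (gap_lists u) (distinct_lists u)"
      "\<And>l. l \<in> gap_lists u \<Longrightarrow> sum_list (F l) = sum_list l"
      "\<And>l. l \<in> gap_lists u \<Longrightarrow> residues u (F l) = residues u l"
    using bij_betw_gap_distinct_lists[OF level1_pair_dvd(5)[OF assms(1)]] unfolding u_def by blast
  have FGD: "bij_betw F G D"
    unfolding G_def D_def by (rule bij_betw_Collect[OF F(1)]) (simp add: F(3))
  have AO1: "bij_betw of_list G (AO1_res t i X)" and AO2: "bij_betw of_list D (AO2_res t i X)"
    using bij_betw_of_list_AO1_res[OF assms] bij_betw_of_list_AO2_res[OF assms]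
    by (simp_all add: G_def D_def u_def S_def)
  have "size ((of_list \<circ> F) l) = size (of_list l)" if "l \<in> G" for l
  proof -
    have "0 \<notin> set l" "0 \<notin> set (F l)"
      using that bij_betwE[OF FGD] gap_lists_increasing[of l u] distinct_lists_increasing[of "F l" u]
      by (auto simp: G_def D_def increasing_lists_def)
    then show ?thesis using that F(2) by (simp add: size_def size_of_list G_def)
  qed
  then obtain f where f: "bij_betw f (AO1_res t i X) (AO2_res t i X)"
      "\<And>\<mu>. \<mu> \<in> AO1_res t i X \<Longrightarrow> size (f \<mu>) = size \<mu>"
    using bij_betw_match[OF AO1 bij_betw_trans[OF FGD AO2], of size size] by blast
  have "bij_betw f (of_size (AO1_res t i X) m) (of_size (AO2_res t i X) m)"
    unfolding of_size_def size_def[symmetric]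
    by (rule bij_betw_Collect[OF f(1)]) (simp add: f(2))
  then show "\<exists>f. bij_betw f (of_size (AO1_res t i X) m) (of_size (AO2_res t i X) m)"
    by blast
qed

end
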